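(* Let $p$ be a prime, let $G$ be a finitely generated group which is residually finite $p$, and let $\theta:G\to G$ be an injective endomorphism. If the endomorphism of $G/G^p[G,G]$ induced by $\theta$ is invertible, then the ascending HNN extension $G*_\theta$ is residually finite.
   Context: A group $G$ is residually finite $p$ if for every non-identity $g\in G$ there is a normal subgroup of $G$ of finite $p$-power index not containing $g$. $G^p[G,G]$ is the subgroup generated by all $p$th powers and all commutators in $G$. For a group $G=\langle X\mid R\rangle$ and an injective endomorphism $\theta:G\to G$ (not necessarily surjective), the ascending HNN extension $G*_\theta$ with stable letter $t$ is the group $\langle X,t\mid R,\ txt^{-1}=\theta(x)\ \forall x\in X\rangle$. *)

theory Defs
  imports "HOL-Algebra.Generated_Groups" "HOL-Computational_Algebra.Primes"
begin

definition finitely_generated_group :: "('a, 'b) monoid_scheme \<Rightarrow> bool" where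
  "finitely_generated_group G \<longleftrightarrow>
     group G \<and> (\<exists>S. finite S \<and> S \<subseteq> carrier G \<and> generate G S = carrier G)"

definition residually_finite :: "('a, 'b) monoid_scheme \<Rightarrow> bool" where
  "residually_finite G \<longleftrightarrow>
     group G \<and>
     (\<forall>g\<in>carrier G. g \<noteq> \<one>\<^bsub>G\<^esub> \<longrightarrow>
        (\<exists>N. N \<lhd> G \<and> finite (rcosets\<^bsub>G\<^esub> N) \<and> g \<notin> N))"

definition residually_finite_p :: "nat \<Rightarrow> ('a, 'b) monoid_scheme \<Rightarrow> bool" where
  "residually_finite_p p G \<longleftrightarrow>
     group G \<and>
     (\<forall>g\<in>carrier G. g \<noteq> \<one>\<^bsub>G\<^esub> \<longrightarrow>
        (\<exists>N. N \<lhd> G \<and> finite (rcosets\<^bsub>G\<^esub> N) \<and>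
             (\<exists>k. card (rcosets\<^bsub>G\<^esub> N) = p ^ k) \<and> g \<notin> N))"

definition power_commutator_subgroup :: "nat \<Rightarrow> ('a, 'b) monoid_scheme \<Rightarrow> 'a set" where
  "power_commutator_subgroup p G =
     generate G ({x [^]\<^bsub>G\<^esub> p |x. x \<in> carrier G} \<union> derived_set G (carrier G))"

text \<open>The map \<open>N x \<mapsto> N \<theta>(x)\<close> on \<open>G/N\<close>. The image of a coset under
  \<open>a \<mapsto> N \<theta>(a)\<close> is a singleton as soon as \<open>\<theta>(N) \<subseteq> N\<close>.\<close>

definition induced_endo ::
  "('a, 'b) monoid_scheme \<Rightarrow> 'a set \<Rightarrow> ('a \<Rightarrow> 'a) \<Rightarrow> 'a set \<Rightarrow> 'a set" where
  "induced_endo G N \<theta> = (\<lambda>A. the_elem ((\<lambda>a. N #>\<^bsub>G\<^esub> \<theta> a) ` A))"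

text \<open>Group words over an alphabet: \<open>(x, True)\<close> is the letter \<open>x\<close> and \<open>(x, False)\<close> the
  letter \<open>x\<inverse>\<close>. Words need not be reduced.\<close>

type_synonym 'x word = "('x \<times> bool) list"

definition words :: "'x set \<Rightarrow> 'x word set" where
  "words X = lists (X \<times> UNIV)"

definition inv_word :: "'x word \<Rightarrow> 'x word" where
  "inv_word w = rev (map (\<lambda>(x, b). (x, \<not> b)) w)"

inductive_set word_cong :: "'x set \<Rightarrow> 'x word set \<Rightarrow> ('x word \<times> 'x word) set"
  for X :: "'x set" and R :: "'x word set" where
  refl: "w \<in> words X \<Longrightarrow> (w, w) \<in> word_cong X R"
| sym: "(u, v) \<in> word_cong X R \<Longrightarrow> (v, u) \<in> word_cong X R"
| trans: "(u, v) \<in> word_cong X R \<Longrightarrow> (v, w) \<in> word_cong X R \<Longrightarrow> (u, w) \<in> word_cong X R"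
| cancel: "u \<in> words X \<Longrightarrow> v \<in> words X \<Longrightarrow> x \<in> X \<Longrightarrow>
    (u @ [(x, b), (x, \<not> b)] @ v, u @ v) \<in> word_cong X R"
| relator: "u \<in> words X \<Longrightarrow> v \<in> words X \<Longrightarrow> r \<in> R \<Longrightarrow>
    (u @ r @ v, u @ v) \<in> word_cong X R"

definition word_class :: "'x set \<Rightarrow> 'x word set \<Rightarrow> 'x word \<Rightarrow> 'x word set" where
  "word_class X R w = word_cong X R `` {w}"

text \<open>The group \<open>\<langle>X | R\<rangle>\<close>; \<open>R\<close> is meant to be a subset of \<open>words X\<close>.\<close>

definition presented_group :: "'x set \<Rightarrow> 'x word set \<Rightarrow> 'x word set monoid" where
  "presented_group X R =
     \<lparr>carrier = words X // word_cong X R,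
      monoid.mult = (\<lambda>A B. \<Union>a\<in>A. \<Union>b\<in>B. word_class X R (a @ b)),
      one = word_class X R []\<rparr>"

text \<open>\<open>G = \<langle>X | R\<rangle>\<close>, where the identification is the isomorphism \<open>\<phi>\<close>.\<close>

definition is_presentation ::
  "('a, 'b) monoid_scheme \<Rightarrow> 'x set \<Rightarrow> 'x word set \<Rightarrow> ('x word set \<Rightarrow> 'a) \<Rightarrow> bool" where
  "is_presentation G X R \<phi> \<longleftrightarrow> R \<subseteq> words X \<and> \<phi> \<in> iso (presented_group X R) G"

definition lift_word :: "'x word \<Rightarrow> 'x option word" where
  "lift_word = map (\<lambda>(x, b). (Some x, b))"

text \<open>The group \<open>\<langle>X, t | R, t x t\<inverse> = \<theta>(x) for x \<in> X\<rangle>\<close>. The alphabet \<open>X \<union> {t}\<close> is encoded by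
  \<open>'x option\<close>, with \<open>t = None\<close> and \<open>x = Some x\<close>. As a relator needs a word for the element
  \<open>\<theta>(x)\<close> of \<open>G\<close>, the relators \<open>t x t\<inverse> w\<inverse>\<close> for all words \<open>w\<close> over \<open>X\<close> that represent
  \<open>\<theta>(x)\<close> are included; these words are equal to one another modulo \<open>R\<close>.\<close>

definition ascending_HNN ::
  "'x set \<Rightarrow> 'x word set \<Rightarrow> ('x word set \<Rightarrow> 'a) \<Rightarrow> ('a \<Rightarrow> 'a) \<Rightarrow> 'x option word set monoid" where
  "ascending_HNN X R \<phi> \<theta> =
     presented_group (insert None (Some ` X))
       (lift_word ` R \<union>
        {[(None, True), (Some x, True), (None, False)] @ inv_word (lift_word w) |x w.
           x \<in> X \<and> w \<in> words X \<and>
           \<phi> (word_class X R w) = \<theta> (\<phi> (word_class X R [(x, True)]))})"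

end

theory Submission
  imports Defs "HOL-Algebra.Group_Action" "HOL-Algebra.Multiplicative_Group"
begin

text \<open>In the extension, \<open>t^n x t^(-n-e)\<close> lies in the image of \<open>G\<close> for all large \<open>n\<close>, where \<open>e\<close> is the
  exponent sum of \<open>t\<close> in \<open>x\<close>. If \<open>e \<noteq> 0\<close>, then \<open>x\<close> survives in a finite cyclic quotient.
  Otherwise \<open>x\<close> is conjugate to the image of some \<open>g \<noteq> 1\<close> in \<open>G\<close>, and \<open>g\<close> survives under a
  homomorphism \<open>f\<close> from \<open>G\<close> to a finite \<open>p\<close>-group \<open>P\<close>. Two homomorphisms to \<open>P\<close> that agree on
  \<open>\<theta>(G)\<close> agree on \<open>\<theta>(G) G\<^sup>p[G,G] = G\<close>: this follows by induction along the upper central series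
  of \<open>P\<close>, as a homomorphism to an elementary abelian \<open>p\<close>-group kills \<open>G\<^sup>p[G,G]\<close>. So composition
  with \<open>\<theta>\<close> permutes the finite set of homomorphisms from \<open>G\<close> to \<open>P\<close>, whence \<open>f \<circ> \<theta>\<^sup>m = f\<close> for
  some \<open>m > 0\<close>. Therefore \<open>f\<close> gives rise to a homomorphism from the extension to the wreath
  product of \<open>P\<close> with \<open>\<int>/m\<close> that does not kill \<open>g\<close>.\<close>

section \<open>Presented groups\<close>

lemma words_append [simp]: "u @ v \<in> words X \<longleftrightarrow> u \<in> words X \<and> v \<in> words X"
  by (simp add: words_def)

lemma words_Nil [simp]: "[] \<in> words X"
  by (simp add: words_def)

lemma words_Cons [simp]: "l # w \<in> words X \<longleftrightarrow> fst l \<in> X \<and> w \<in> words X"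
  by (cases l) (simp add: words_def)

lemma inv_word_simps [simp]:
  "inv_word [] = []"
  "inv_word ((x, b) # w) = inv_word w @ [(x, \<not> b)]"
  "inv_word (u @ v) = inv_word v @ inv_word u"
  by (simp_all add: inv_word_def)

lemma inv_word_in_words [simp]: "inv_word w \<in> words X \<longleftrightarrow> w \<in> words X"
  by (induction w) auto

lemma inv_word_inv_word [simp]: "inv_word (inv_word w) = w"
  by (induction w) auto

lemma word_cong_append_right:
  assumes "(u, v) \<in> word_cong X R" "w \<in> words X"
  shows "(u @ w, v @ w) \<in> word_cong X R"
  using assms
proof (induction rule: word_cong.induct)
  case (cancel u v x b)
  then show ?case using word_cong.cancel[where u=u and v="v @ w"] by simp
next
  case (relator u v r)
  then show ?case using word_cong.relator[where u=u and v="v @ w"] by simp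
qed (auto intro: word_cong.intros)

lemma word_cong_append_left:
  assumes "(u, v) \<in> word_cong X R" "w \<in> words X"
  shows "(w @ u, w @ v) \<in> word_cong X R"
  using assms
proof (induction rule: word_cong.induct)
  case (cancel u v x b)
  then show ?case using word_cong.cancel[where u="w @ u" and v=v] by simp
next
  case (relator u v r)
  then show ?case using word_cong.relator[where u="w @ u" and v=v] by simp
qed (auto intro: word_cong.intros)

lemma word_cong_inv_right:
  assumes "w \<in> words X"
  shows "(w @ inv_word w, []) \<in> word_cong X R"
  using assms
proof (induction w)
  case Nil
  show ?case by (simp add: word_cong.refl)
next
  case (Cons l w)
  obtain x b where l: "l = (x, b)" by (cases l)
  have x: "x \<in> X" and w: "w \<in> words X" using Cons.prems l by auto
  \<comment> \<open>\<open>inv_word\<close> puts the inverse of the first letter last, so the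
    induction hypothesis cancels everything between the two outermost letters.\<close>
  have "([(x, b)] @ (w @ inv_word w) @ [(x, \<not> b)], [(x, b)] @ [] @ [(x, \<not> b)]) \<in> word_cong X R"
    using x w by (intro word_cong_append_left word_cong_append_right Cons.IH) simp_all
  moreover have "([] @ [(x, b), (x, \<not> b)] @ [], [] @ []) \<in> word_cong X R"
    using x by (intro word_cong.cancel) simp_all
  ultimately show ?case using l by (auto intro: word_cong.trans)
qed

lemma word_cong_inv_left:
  "w \<in> words X \<Longrightarrow> (inv_word w @ w, []) \<in> word_cong X R"
  using word_cong_inv_right[of "inv_word w"] by simp

context
  fixes X :: "'x set" and R :: "'x word set"
  assumes R: "R \<subseteq> words X"
begin

lemma word_cong_words:
  assumes "(u, v) \<in> word_cong X R"
  shows "u \<in> words X" "v \<in> words X"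
  using assms R by (induction rule: word_cong.induct) auto

lemma equiv_word_cong: "equiv (words X) (word_cong X R)"
proof (rule equivI)
  show "word_cong X R \<subseteq> words X \<times> words X" using word_cong_words by auto
  show "refl_on (words X) (word_cong X R)" by (auto simp: refl_on_def intro: word_cong.refl)
  show "sym (word_cong X R)" by (auto intro!: symI word_cong.sym)
  show "trans (word_cong X R)" by (auto intro!: transI intro: word_cong.trans)
qed

lemma word_class_eq_iff:
  assumes "u \<in> words X" "v \<in> words X"
  shows "word_class X R u = word_class X R v \<longleftrightarrow> (u, v) \<in> word_cong X R"
  unfolding word_class_def using eq_equiv_class_iff[OF equiv_word_cong assms] .

lemma word_class_in_carrier [simp]:
  "w \<in> words X \<Longrightarrow> word_class X R w \<in> carrier (presented_group X R)"
  by (auto simp: presented_group_def word_class_def intro: quotientI)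

lemma carrier_presented_groupE:
  assumes "A \<in> carrier (presented_group X R)"
  obtains w where "w \<in> words X" "A = word_class X R w"
  using assms by (auto simp: presented_group_def word_class_def elim: quotientE)

lemma one_presented_group: "\<one>\<^bsub>presented_group X R\<^esub> = word_class X R []"
  by (simp add: presented_group_def)

text \<open>The union in the product runs over all representatives. Exchanging them one factor at a
  time keeps the concatenation in its class, so the union is a single class.\<close>

lemma mult_word_class:
  assumes "u \<in> words X" "v \<in> words X"
  shows "word_class X R u \<otimes>\<^bsub>presented_group X R\<^esub> word_class X R v = word_class X R (u @ v)"
proof -
  have "word_class X R (a @ b) = word_class X R (u @ v)"
    if "a \<in> word_class X R u" "b \<in> word_class X R v" for a b
  proof -
    have ab: "(u, a) \<in> word_cong X R" "(v, b) \<in> word_cong X R"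
      using that by (auto simp: word_class_def)
    note w = ab[THEN word_cong_words(2)]
    have "(u @ v, a @ b) \<in> word_cong X R"
      using word_cong_append_right[OF ab(1) assms(2)] word_cong_append_left[OF ab(2) w(1)]
      by (rule word_cong.trans)
    then show ?thesis using assms w by (simp add: word_class_eq_iff word_cong.sym)
  qed
  note class_eq = this
  have "u \<in> word_class X R u" "v \<in> word_class X R v"
    using assms by (auto simp: word_class_def intro: word_cong.refl)
  then have "(\<Union>a\<in>word_class X R u. \<Union>b\<in>word_class X R v. word_class X R (a @ b)) = word_class X R (u @ v)"
    using class_eq by blast
  then show ?thesis by (simp add: presented_group_def)
qed

lemma group_presented_group: "group (presented_group X R)"
proof (rule groupI)
  show "\<one>\<^bsub>presented_group X R\<^esub> \<in> carrier (presented_group X R)"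
    by (simp add: one_presented_group)
next
  fix A B
  assume "A \<in> carrier (presented_group X R)" "B \<in> carrier (presented_group X R)"
  then obtain u v where "u \<in> words X" "A = word_class X R u" "v \<in> words X" "B = word_class X R v"
    by (auto elim!: carrier_presented_groupE)
  then show "A \<otimes>\<^bsub>presented_group X R\<^esub> B \<in> carrier (presented_group X R)"
    by (simp add: mult_word_class)
next
  fix A B C
  assume "A \<in> carrier (presented_group X R)" "B \<in> carrier (presented_group X R)"
    "C \<in> carrier (presented_group X R)"
  then obtain u v w where "u \<in> words X" "A = word_class X R u" "v \<in> words X" "B = word_class X R v"
    "w \<in> words X" "C = word_class X R w"
    by (auto elim!: carrier_presented_groupE)
  then show "A \<otimes>\<^bsub>presented_group X R\<^esub> B \<otimes>\<^bsub>presented_group X R\<^esub> C =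
      A \<otimes>\<^bsub>presented_group X R\<^esub> (B \<otimes>\<^bsub>presented_group X R\<^esub> C)"
    by (simp add: mult_word_class)
next
  fix A
  assume "A \<in> carrier (presented_group X R)"
  then obtain u where u: "u \<in> words X" "A = word_class X R u"
    by (auto elim!: carrier_presented_groupE)
  then show "\<one>\<^bsub>presented_group X R\<^esub> \<otimes>\<^bsub>presented_group X R\<^esub> A = A"
    by (simp add: one_presented_group mult_word_class)
  have "word_class X R (inv_word u) \<otimes>\<^bsub>presented_group X R\<^esub> A = \<one>\<^bsub>presented_group X R\<^esub>"
    using u by (simp add: one_presented_group mult_word_class word_class_eq_iff word_cong_inv_left)
  then show "\<exists>B\<in>carrier (presented_group X R). B \<otimes>\<^bsub>presented_group X R\<^esub> A = \<one>\<^bsub>presented_group X R\<^esub>"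
    using u by (intro bexI[of _ "word_class X R (inv_word u)"]) simp_all
qed

lemma inv_word_class:
  assumes "w \<in> words X"
  shows "inv\<^bsub>presented_group X R\<^esub> word_class X R w = word_class X R (inv_word w)"
  using assms
  by (intro group.inv_equality[OF group_presented_group])
     (simp_all add: one_presented_group mult_word_class word_class_eq_iff word_cong_inv_left)

lemma word_class_relator:
  "r \<in> R \<Longrightarrow> word_class X R r = \<one>\<^bsub>presented_group X R\<^esub>"
  using R word_cong.relator[of "[]" X "[]" r R] word_class_eq_iff[of r "[]"]
  by (auto simp: one_presented_group)

end

section \<open>Evaluation of words in a group and the universal property of presentations\<close>

fun letter_val :: "('k, 'm) monoid_scheme \<Rightarrow> ('x \<Rightarrow> 'k) \<Rightarrow> 'x \<times> bool \<Rightarrow> 'k" where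
  "letter_val K \<psi> (x, b) = (if b then \<psi> x else inv\<^bsub>K\<^esub> \<psi> x)"

primrec word_val :: "('k, 'm) monoid_scheme \<Rightarrow> ('x \<Rightarrow> 'k) \<Rightarrow> 'x word \<Rightarrow> 'k" where
  "word_val K \<psi> [] = \<one>\<^bsub>K\<^esub>"
| "word_val K \<psi> (l # w) = letter_val K \<psi> l \<otimes>\<^bsub>K\<^esub> word_val K \<psi> w"

context group
begin

context
  fixes X :: "'x set" and \<psi> :: "'x \<Rightarrow> 'a"
  assumes \<psi>: "\<psi> \<in> X \<rightarrow> carrier G"
begin

lemma letter_val_closed [simp]: "fst l \<in> X \<Longrightarrow> letter_val G \<psi> l \<in> carrier G"
  using \<psi> by (cases l) auto

lemma word_val_closed [simp]: "w \<in> words X \<Longrightarrow> word_val G \<psi> w \<in> carrier G"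
  by (induction w) simp_all

lemma word_val_append:
  "u \<in> words X \<Longrightarrow> v \<in> words X \<Longrightarrow> word_val G \<psi> (u @ v) = word_val G \<psi> u \<otimes> word_val G \<psi> v"
  by (induction u) (simp_all add: m_assoc)

lemma letter_val_flip: "x \<in> X \<Longrightarrow> letter_val G \<psi> (x, \<not> b) = inv letter_val G \<psi> (x, b)"
  using \<psi> by (cases b) (auto dest!: funcset_mem)

lemma word_val_inv_word: "w \<in> words X \<Longrightarrow> word_val G \<psi> (inv_word w) = inv word_val G \<psi> w"
proof (induction w)
  case (Cons l w)
  obtain x b where l: "l = (x, b)" by (cases l)
  have "x \<in> X" "w \<in> words X" using Cons.prems l by auto
  then show ?case
    using Cons.IH l letter_val_flip[of x b]
    by (simp add: word_val_append inv_mult_group del: letter_val.simps)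
qed simp

lemma word_val_cong:
  assumes "R \<subseteq> words X" and rel: "\<And>r. r \<in> R \<Longrightarrow> word_val G \<psi> r = \<one>"
    and "(u, v) \<in> word_cong X R"
  shows "word_val G \<psi> u = word_val G \<psi> v"
  using assms(3)
proof (induction rule: word_cong.induct)
  case (cancel u v x b)
  then have "letter_val G \<psi> (x, b) \<otimes> (letter_val G \<psi> (x, \<not> b) \<otimes> word_val G \<psi> v) = word_val G \<psi> v"
    using letter_val_flip[of x b] by (simp flip: m_assoc del: letter_val.simps)
  then show ?case using cancel by (simp add: word_val_append del: letter_val.simps)
next
  case (relator u v r)
  then have "r \<in> words X" using assms(1) by auto
  then show ?case using relator rel by (simp add: word_val_append)
qed simp_all

text \<open>Von Dyck's theorem. Inverse pairs and relators evaluate to the identity, so evaluation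
  is constant on each class and the representative picked in \<open>F\<close> does not
  matter.\<close>

lemma presented_group_universal:
  assumes R: "R \<subseteq> words X" and rel: "\<And>r. r \<in> R \<Longrightarrow> word_val G \<psi> r = \<one>"
  obtains F where "F \<in> hom (presented_group X R) G"
    "\<And>w. w \<in> words X \<Longrightarrow> F (word_class X R w) = word_val G \<psi> w"
proof
  define F where "F A = word_val G \<psi> (SOME w. w \<in> words X \<and> word_class X R w = A)" for A
  show F: "F (word_class X R w) = word_val G \<psi> w" if w: "w \<in> words X" for w
  proof -
    let ?v = "SOME v. v \<in> words X \<and> word_class X R v = word_class X R w"
    have v: "?v \<in> words X \<and> word_class X R ?v = word_class X R w"
      by (rule someI[of _ w]) (simp add: w)
    then have "(?v, w) \<in> word_cong X R" using word_class_eq_iff[OF R _ w] by blast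
    from word_val_cong[OF R rel this] show ?thesis unfolding F_def .
  qed
  show "F \<in> hom (presented_group X R) G"
  proof (rule homI)
    fix A assume "A \<in> carrier (presented_group X R)"
    then show "F A \<in> carrier G" by (auto elim!: carrier_presented_groupE[OF R] simp: F)
  next
    fix A B assume "A \<in> carrier (presented_group X R)" "B \<in> carrier (presented_group X R)"
    then show "F (A \<otimes>\<^bsub>presented_group X R\<^esub> B) = F A \<otimes> F B"
      by (auto elim!: carrier_presented_groupE[OF R] simp: F mult_word_class[OF R] word_val_append)
  qed
qed

end

end

section \<open>Homomorphisms to finite p-groups\<close>

text \<open>The largest central subgroup of exponent dividing \<open>p\<close>. It takes the place
  of the center in the upper central series, because a homomorphism to an abelian group of exponent
  \<open>p\<close> kills \<open>p\<close>th powers as well as commutators.\<close>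

definition (in group) p_center :: "nat \<Rightarrow> 'a set" where
  "p_center p = {c \<in> carrier G. (\<forall>x\<in>carrier G. c \<otimes> x = x \<otimes> c) \<and> c [^] p = \<one>}"

lemma (in group) p_centerD:
  assumes "c \<in> p_center p"
  shows "c \<in> carrier G" "x \<in> carrier G \<Longrightarrow> c \<otimes> x = x \<otimes> c" "c [^] p = \<one>"
  using assms unfolding p_center_def by blast+

lemma (in group) p_centerI:
  assumes "c \<in> carrier G" "\<And>x. x \<in> carrier G \<Longrightarrow> c \<otimes> x = x \<otimes> c" "c [^] p = \<one>"
  shows "c \<in> p_center p"
  using assms unfolding p_center_def by blast

lemma (in group) p_center_normal: "p_center p \<lhd> G"
proof -
  have sub: "subgroup (p_center p) G"
  proof (rule subgroupI)
    show "p_center p \<subseteq> carrier G" using p_centerD by blast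
    show "p_center p \<noteq> {}" using p_centerI[of \<one> p] by auto
  next
    fix a assume a: "a \<in> p_center p"
    note aD = p_centerD[OF a]
    show "inv a \<in> p_center p"
    proof (rule p_centerI)
      fix x assume x: "x \<in> carrier G"
      have "a \<otimes> (x \<otimes> inv a) = x"
        using aD(1) aD(2)[of "x \<otimes> inv a"] x by (simp add: m_assoc)
      then show "inv a \<otimes> x = x \<otimes> inv a" using aD(1) x by (simp add: inv_solve_left')
    qed (use aD(1,3) in \<open>simp_all add: nat_pow_inv\<close>)
  next
    fix a b assume a: "a \<in> p_center p" and b: "b \<in> p_center p"
    note aD = p_centerD[OF a] and bD = p_centerD[OF b]
    show "a \<otimes> b \<in> p_center p"
    proof (rule p_centerI)
      fix x assume x: "x \<in> carrier G"
      show "a \<otimes> b \<otimes> x = x \<otimes> (a \<otimes> b)"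
        using aD(1) bD(1) aD(2)[OF x] bD(2)[OF x] x by (metis m_assoc)
    next
      show "(a \<otimes> b) [^] p = \<one>"
        using pow_mult_distrib[OF aD(2)[OF bD(1)] aD(1) bD(1)] aD(3) bD(3) by simp
    qed (use aD(1) bD(1) in simp)
  qed
  have "x \<otimes> a \<otimes> inv x \<in> p_center p" if x: "x \<in> carrier G" and a: "a \<in> p_center p" for x a
  proof -
    have "x \<otimes> a \<otimes> inv x = a"
      using p_centerD(1)[OF a] p_centerD(2)[OF a x, symmetric] x by (simp add: m_assoc)
    then show ?thesis using a by simp
  qed
  then show ?thesis using sub by (simp add: normal_inv_iff)
qed

text \<open>Class equation: conjugacy classes have \<open>p\<close>-power size. If only the identity
  were central, every class but its own would have size divisible by \<open>p\<close>; as
  \<open>p\<close> divides the group order, it would divide 1.\<close>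

lemma (in group) p_group_center_nontrivial:
  assumes p: "prime p" and ord: "order G = p ^ k" and k: "k > 0"
  obtains c where "c \<in> carrier G" "c \<noteq> \<one>" "\<And>x. x \<in> carrier G \<Longrightarrow> c \<otimes> x = x \<otimes> c"
proof (rule ccontr)
  note thesisI = that
  assume "\<not> thesis"
  then have no_center: "\<exists>g\<in>carrier G. x \<otimes> g \<noteq> g \<otimes> x" if "x \<in> carrier G" "x \<noteq> \<one>" for x
    using thesisI[OF that] by blast
  define conj where "conj = (\<lambda>g. \<lambda>h\<in>carrier G. g \<otimes> h \<otimes> inv g)"
  interpret act: group_action G "carrier G" conj
    unfolding conj_def by (rule action_by_conjugation)
  have p0: "p > 0" using p by (simp add: prime_gt_0_nat)
  then have fin: "finite (carrier G)" using ord by (simp flip: order_gt_0_iff_finite)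
  have orb1: "orbit G conj \<one> = {\<one>}"
    by (auto simp: orbit_def conj_def intro!: exI[of _ \<one>])
  have dvd: "p dvd card orb" if orb: "orb \<in> orbits G (carrier G) conj" "orb \<noteq> {\<one>}" for orb
  proof -
    obtain x where x: "x \<in> carrier G" "orb = orbit G conj x"
      using orb(1) by (auto simp: orbits_def)
    then have x1: "x \<noteq> \<one>" using orb(2) orb1 by auto
    have "card orb dvd p ^ k"
      using act.orbit_stabilizer_theorem[OF x(1)] x(2) ord by (metis dvd_triv_left)
    then obtain i where i: "card orb = p ^ i" using divides_primepow_nat[OF p] by auto
    \<comment> \<open>A class with a single element consists of a central element, here one
      different from the identity.\<close>
    have "i \<noteq> 0"
    proof
      assume "i = 0"
      then have "card orb = 1" using i by simp
      moreover have "x \<in> orb" using act.orbit_refl[OF x(1)] x(2) by simp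
      ultimately have orbx: "orb = {x}" by (metis card_1_singletonE singletonD)
      have "x \<otimes> g = g \<otimes> x" if g: "g \<in> carrier G" for g
      proof -
        have "conj g x \<in> orb" using g x(2) by (auto simp: orbit_def)
        then have "g \<otimes> x \<otimes> inv g = x" using orbx x(1) by (simp add: conj_def)
        then show ?thesis using g x(1) by (metis inv_solve_right m_closed)
      qed
      then show False using no_center[OF x(1) x1] by blast
    qed
    then show ?thesis using i by (simp add: dvd_power)
  qed
  have "(\<Sum>orb\<in>orbits G (carrier G) conj. card orb) = card (carrier G)"
    using act.disjoint_sum[OF fin, of "\<lambda>_. 1::nat"] by simp
  moreover have one: "{\<one>} \<in> orbits G (carrier G) conj"
    using orb1 by (auto simp: orbits_def)
  moreover have "finite (orbits G (carrier G) conj)"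
    using fin by (auto simp: orbits_def)
  ultimately have "card (carrier G) = 1 + (\<Sum>orb\<in>orbits G (carrier G) conj - {{\<one>}}. card orb)"
    by (metis (no_types, lifting) sum.remove card.empty card.insert empty_iff finite.emptyI One_nat_def)
  moreover have "p dvd (\<Sum>orb\<in>orbits G (carrier G) conj - {{\<one>}}. card orb)"
    using dvd by (intro dvd_sum) auto
  moreover have "p dvd card (carrier G)" using ord k by (simp add: order_def dvd_power)
  ultimately have "p dvd 1" by (metis dvd_add_left_iff)
  then show False using p by (simp add: prime_nat_iff)
qed

text \<open>A nontrivial central element has \<open>p\<close>-power order, so among its iterated
  \<open>p\<close>th powers there is a last nontrivial one. That power has order \<open>p\<close>
  and is still central.\<close>

lemma (in group) p_center_nontrivial:
  assumes p: "prime p" and ord: "order G = p ^ k" and k: "k > 0"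
  obtains c where "c \<in> p_center p" "c \<noteq> \<one>"
proof -
  obtain c where c: "c \<in> carrier G" "c \<noteq> \<one>" "\<And>x. x \<in> carrier G \<Longrightarrow> c \<otimes> x = x \<otimes> c"
    using p_group_center_nontrivial[OF assms] by blast
  define j where "j = (LEAST j. c [^] (p ^ j) = \<one>)"
  have "c [^] (p ^ k) = \<one>" using pow_order_eq_1[OF c(1)] ord by simp
  then have j: "c [^] (p ^ j) = \<one>" unfolding j_def by (rule LeastI)
  then obtain i where i: "j = Suc i" using c by (cases j) auto
  have "c [^] (p ^ i) \<noteq> \<one>" using i not_less_Least[of i "\<lambda>j. c [^] (p ^ j) = \<one>"] by (simp add: j_def)
  moreover have "(c [^] (p ^ i)) [^] p = \<one>" using j i c(1) by (simp add: nat_pow_pow mult.commute)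
  moreover have "c [^] (n::nat) \<otimes> x = x \<otimes> c [^] n" if x: "x \<in> carrier G" for x n
  proof (induction n)
    case (Suc n)
    have "c [^] n \<otimes> (c \<otimes> x) = c [^] n \<otimes> (x \<otimes> c)" using c(3)[OF x] by simp
    then show ?case using Suc c(1) x by (simp add: m_assoc) (simp flip: m_assoc)
  qed (use x in simp)
  ultimately show ?thesis using c(1) by (intro that[of "c [^] (p ^ i)"] p_centerI) simp_all
qed

section \<open>Rigidity of homomorphisms to a finite p-group\<close>

lemma (in group) preimage_normal:
  assumes "group Q" "\<pi> \<in> hom G Q" "N \<lhd> Q"
  shows "{x \<in> carrier G. \<pi> x \<in> N} \<lhd> G"
proof -
  interpret Q: group Q by fact
  interpret \<pi>: group_hom G Q \<pi> by unfold_locales fact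
  interpret N: normal N Q by fact
  have "subgroup {x \<in> carrier G. \<pi> x \<in> N} G"
    by (rule subgroupI) (auto intro!: exI[of _ \<one>])
  then show ?thesis by (auto simp: normal_inv_iff N.inv_op_closed2)
qed

text \<open>The difference \<open>d\<close> of the two homomorphisms has values in the p-center,
  hence is itself a homomorphism and kills \<open>p\<close>th powers and commutators. It also kills
  \<open>L\<close>, where the two agree, and by \<open>gen\<close> these together make up all of
  \<open>G\<close>.\<close>

lemma (in group) homs_eq_if_central_difference:
  assumes Q: "group Q" and F: "F1 \<in> hom G Q" "F2 \<in> hom G Q"
    and gen: "\<And>g. g \<in> carrier G \<Longrightarrow> \<exists>v\<in>power_commutator_subgroup p G. \<exists>l\<in>L. g = v \<otimes> l"
    and L: "L \<subseteq> carrier G" "\<And>l. l \<in> L \<Longrightarrow> F1 l = F2 l"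
    and central: "\<And>g. g \<in> carrier G \<Longrightarrow> F1 g \<otimes>\<^bsub>Q\<^esub> inv\<^bsub>Q\<^esub> F2 g \<in> group.p_center Q p"
    and g: "g \<in> carrier G"
  shows "F1 g = F2 g"
proof -
  interpret Q: group Q by fact
  interpret F1: group_hom G Q F1 by unfold_locales fact
  interpret F2: group_hom G Q F2 by unfold_locales fact
  define d where "d g = F1 g \<otimes>\<^bsub>Q\<^esub> inv\<^bsub>Q\<^esub> F2 g" for g
  have d: "d x \<in> Q.p_center p" if "x \<in> carrier G" for x
    using central[OF that] by (simp add: d_def)
  note dc = Q.p_centerD(1)[OF d] Q.p_centerD(3)[OF d] and comm = Q.p_centerD(2)[OF d]
  have "d (x \<otimes> y) = d x \<otimes>\<^bsub>Q\<^esub> d y" if xy: "x \<in> carrier G" "y \<in> carrier G" for x y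
  proof -
    \<comment> \<open>Inversion reverses the factors, so \<open>d y\<close> sits in the middle and,
      being central, can move past the inverse of \<open>F2 x\<close>.\<close>
    have "d (x \<otimes> y) = F1 x \<otimes>\<^bsub>Q\<^esub> (d y \<otimes>\<^bsub>Q\<^esub> inv\<^bsub>Q\<^esub> F2 x)"
      using xy by (simp add: d_def Q.inv_mult_group Q.m_assoc)
    also have "\<dots> = d x \<otimes>\<^bsub>Q\<^esub> d y"
      using xy comm[of y "inv\<^bsub>Q\<^esub> F2 x"] dc by (simp add: d_def Q.m_assoc)
    finally show ?thesis .
  qed
  then interpret d: group_hom G Q d
    using dc by unfold_locales (auto intro: homI)
  have V: "power_commutator_subgroup p G \<subseteq> kernel G Q d"
    unfolding power_commutator_subgroup_def
  proof (rule generate_subgroup_incl[OF _ d.subgroup_kernel], safe)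
    fix x assume "x \<in> carrier G"
    then show "x [^] p \<in> kernel G Q d" by (simp add: kernel_def d.hom_nat_pow dc)
  next
    fix x y assume "x \<in> carrier G" "y \<in> carrier G"
    then show "x \<otimes> y \<otimes> inv x \<otimes> inv y \<in> kernel G Q d"
      using comm[of x "d y"] by (simp add: kernel_def) (simp add: Q.m_assoc)
  qed
  have dL: "d l = \<one>\<^bsub>Q\<^esub>" if "l \<in> L" for l using L that by (auto simp: d_def)
  obtain v l where "v \<in> power_commutator_subgroup p G" "l \<in> L" "g = v \<otimes> l"
    using gen[OF g] by blast
  then have "d g = \<one>\<^bsub>Q\<^esub>" using V dL L(1) by (auto simp: kernel_def subset_eq)
  then show ?thesis using g Q.inv_equality[of "F1 g" "inv\<^bsub>Q\<^esub> F2 g"] by (simp add: d_def)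
qed

text \<open>The differences of \<open>f1\<close> and \<open>f2\<close> are shown to lie in every
  normal subgroup \<open>Z\<close> of \<open>P\<close>; the trivial subgroup gives the claim. The
  induction descends from \<open>Z = P\<close>, where nothing is to be shown, and each step passes
  from a larger normal subgroup to \<open>Z\<close> through the p-center of
  \<open>P Mod Z\<close>.\<close>

lemma (in group) homs_into_p_group_eq:
  assumes P: "group P" and p: "prime p" and ord: "order P = p ^ n"
    and f: "f1 \<in> hom G P" "f2 \<in> hom G P"
    and gen: "\<And>g. g \<in> carrier G \<Longrightarrow> \<exists>v\<in>power_commutator_subgroup p G. \<exists>l\<in>L. g = v \<otimes> l"
    and L: "L \<subseteq> carrier G" "\<And>l. l \<in> L \<Longrightarrow> f1 l = f2 l"
    and g: "g \<in> carrier G"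
  shows "f1 g = f2 g"
proof -
  interpret P: group P by fact
  interpret f1: group_hom G P f1 by unfold_locales fact
  interpret f2: group_hom G P f2 by unfold_locales fact
  have "p > 0" using p by (simp add: prime_gt_0_nat)
  then have fin: "finite (carrier P)" using ord by (simp flip: P.order_gt_0_iff_finite)
  have "\<forall>g\<in>carrier G. f1 g \<otimes>\<^bsub>P\<^esub> inv\<^bsub>P\<^esub> f2 g \<in> Z" if "Z \<lhd> P" for Z
    using that
  proof (induction "card (carrier P) - card Z" arbitrary: Z rule: less_induct)
    case less
    interpret Z: normal Z P by fact
    show ?case
    proof (cases "Z = carrier P")
      case False
      then have "Z \<subset> carrier P" using Z.subset by auto
      then have Zc: "card Z < card (carrier P)" using fin by (simp add: psubset_card_mono)
      define Q where "Q = P Mod Z"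
      interpret Q: group Q unfolding Q_def by (rule Z.factorgroup_is_group)
      define \<pi> where "\<pi> x = Z #>\<^bsub>P\<^esub> x" for x
      have \<pi>: "\<pi> \<in> hom P Q" unfolding \<pi>_def Q_def by (rule Z.r_coset_hom_Mod)
      interpret \<pi>: group_hom P Q \<pi> by unfold_locales fact
      have \<pi>_eq: "\<pi> x = \<pi> y \<longleftrightarrow> x \<otimes>\<^bsub>P\<^esub> inv\<^bsub>P\<^esub> y \<in> Z" if "x \<in> carrier P" "y \<in> carrier P" for x y
        unfolding \<pi>_def using that Z.is_subgroup
        by (metis P.rcos_self P.repr_independence Z.rcos_module P.is_group)
      have ordQ: "order Q * card Z = p ^ n"
        using P.lagrange[OF Z.is_subgroup] ord by (simp add: Q_def order_def FactGroup_def)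
      then obtain k where k: "order Q = p ^ k"
        using divides_primepow_nat[OF p, of "order Q" n] by (metis dvd_triv_left)
      have "order Q \<noteq> 1" using Zc ordQ ord by (auto simp: order_def)
      then have "k > 0" using k by (cases k) auto
      then obtain c where c: "c \<in> Q.p_center p" "c \<noteq> \<one>\<^bsub>Q\<^esub>"
        using Q.p_center_nontrivial[OF p k] by blast
      \<comment> \<open>The next larger subgroup of the series: modulo \<open>Z\<close> it is the
        p-center of the quotient.\<close>
      define Z' where "Z' = {x \<in> carrier P. \<pi> x \<in> Q.p_center p}"
      have Z': "Z' \<lhd> P"
        unfolding Z'_def by (rule P.preimage_normal[OF Q.is_group \<pi> Q.p_center_normal])
      have one: "\<one>\<^bsub>Q\<^esub> \<in> Q.p_center p" by (simp add: Q.p_center_def)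
      have ker: "\<pi> x = \<one>\<^bsub>Q\<^esub> \<longleftrightarrow> x \<in> Z" if "x \<in> carrier P" for x
        using \<pi>_eq[OF that P.one_closed] that by simp
      have "Z \<subseteq> Z'"
      proof
        fix x assume "x \<in> Z"
        then show "x \<in> Z'" using ker[of x] one Z.subset unfolding Z'_def by force
      qed
      \<comment> \<open>A preimage of the nontrivial \<open>c\<close> lies in \<open>Z'\<close> but
        not in \<open>Z\<close>, so the induction measure drops.\<close>
      moreover obtain x where x: "x \<in> carrier P" "c = \<pi> x"
        using Q.p_centerD(1)[OF c(1)] by (auto simp: Q_def \<pi>_def FactGroup_def RCOSETS_def)
      then have "x \<in> Z'" "x \<notin> Z" using c ker by (auto simp: Z'_def)
      ultimately have "Z \<subset> Z'" by blast
      moreover have "finite Z'" using fin by (simp add: Z'_def)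
      ultimately have "card Z < card Z'" by (simp add: psubset_card_mono)
      moreover have "card Z' \<le> card (carrier P)" using fin by (auto simp: Z'_def intro: card_mono)
      ultimately have IH: "\<forall>g\<in>carrier G. f1 g \<otimes>\<^bsub>P\<^esub> inv\<^bsub>P\<^esub> f2 g \<in> Z'"
        using Zc by (intro less.hyps Z') simp
      \<comment> \<open>By the induction hypothesis the differences modulo \<open>Z\<close> lie in
        the p-center of \<open>Q\<close>, so the central case applies to the composites with
        \<open>\<pi>\<close>.\<close>
      have "(\<pi> \<circ> f1) g = (\<pi> \<circ> f2) g" if "g \<in> carrier G" for g
      proof (rule homs_eq_if_central_difference[OF Q.is_group _ _ gen L(1) _ _ that])
        show "\<pi> \<circ> f1 \<in> hom G Q" "\<pi> \<circ> f2 \<in> hom G Q" using Group.hom_compose[OF f(1) \<pi>] Group.hom_compose[OF f(2) \<pi>] by simp_all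
        show "(\<pi> \<circ> f1) g \<otimes>\<^bsub>Q\<^esub> inv\<^bsub>Q\<^esub> (\<pi> \<circ> f2) g \<in> Q.p_center p" if "g \<in> carrier G" for g
          using IH that by (auto simp: Z'_def)
      qed (simp_all add: L)
      then show ?thesis using \<pi>_eq by simp
    qed auto
  qed
  from this[OF P.one_is_normal] g have "f1 g \<otimes>\<^bsub>P\<^esub> inv\<^bsub>P\<^esub> f2 g = \<one>\<^bsub>P\<^esub>"
    by simp
  then show ?thesis using g P.inv_equality[of "f1 g" "inv\<^bsub>P\<^esub> f2 g"] by simp
qed

section \<open>Periodicity of homomorphisms to a finite p-group under composition with
  \<open>\<theta>\<close>\<close>

lemma (in group_hom) agree_on_generate:
  assumes "h' \<in> hom G H" "S \<subseteq> carrier G" "\<And>s. s \<in> S \<Longrightarrow> h s = h' s" "g \<in> generate G S"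
  shows "h g = h' g"
proof -
  interpret h': group_hom G H h' by unfold_locales fact
  from assms(4) show ?thesis
  proof (induction rule: generate.induct)
    case (eng a b)
    then show ?case using G.generate_in_carrier[OF assms(2)] by simp
  qed (use assms(2,3) in auto)
qed

text \<open>Surjectivity of the induced map, unwound: each coset is the coset of some
  \<open>\<theta> a\<close>. This supplies the hypothesis \<open>gen\<close> of the rigidity lemma,
  with the image of \<open>\<theta>\<close> as \<open>L\<close>.\<close>

lemma (in group) endo_image_mod_power_commutator:
  assumes \<theta>: "\<theta> \<in> hom G G"
    and iso: "induced_endo G (power_commutator_subgroup p G) \<theta>
      \<in> iso (G Mod power_commutator_subgroup p G) (G Mod power_commutator_subgroup p G)"
    and g: "g \<in> carrier G"
  shows "\<exists>v\<in>power_commutator_subgroup p G. \<exists>l\<in>\<theta> ` carrier G. g = v \<otimes> l"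
proof -
  interpret \<theta>: group_hom G G \<theta> by unfold_locales fact
  define S where "S = {x [^] p |x. x \<in> carrier G} \<union> derived_set G (carrier G)"
  define V where "V = power_commutator_subgroup p G"
  have S: "S \<subseteq> carrier G" by (auto simp: S_def)
  have VS: "V = generate G S" by (simp add: V_def S_def power_commutator_subgroup_def)
  interpret V: subgroup V G unfolding VS by (rule generate_is_subgroup[OF S])
  \<comment> \<open>Endomorphisms preserve \<open>p\<close>th powers and commutators, so the
    subgroup \<open>V\<close> that these generate is mapped into itself.\<close>
  have "\<theta> ` S \<subseteq> S"
  proof
    fix y assume "y \<in> \<theta> ` S"
    then consider x where "x \<in> carrier G" "y = \<theta> (x [^] p)"
      | a b where "a \<in> carrier G" "b \<in> carrier G" "y = \<theta> (a \<otimes> b \<otimes> inv a \<otimes> inv b)"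
      unfolding S_def by blast
    then show "y \<in> S"
    proof cases
      case 1
      then have "y = \<theta> x [^] p" "\<theta> x \<in> carrier G" by (simp_all add: \<theta>.hom_nat_pow)
      then show ?thesis unfolding S_def by blast
    next
      case 2
      then have "y = \<theta> a \<otimes> \<theta> b \<otimes> inv \<theta> a \<otimes> inv \<theta> b" "\<theta> a \<in> carrier G" "\<theta> b \<in> carrier G" by simp_all
      then show ?thesis unfolding S_def by blast
    qed
  qed
  then have \<theta>V: "\<theta> ` V \<subseteq> V"
    unfolding VS using \<theta>.generate_img[OF S] mono_generate by blast
  have "V #> g \<in> induced_endo G V \<theta> ` carrier (G Mod V)"
    using iso g by (simp add: iso_def bij_betw_def V_def[symmetric]) (auto simp: FactGroup_def RCOSETS_def)
  then obtain a where a: "a \<in> carrier G" "V #> g = induced_endo G V \<theta> (V #> a)"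
    by (auto simp: FactGroup_def RCOSETS_def)
  \<comment> \<open>Invariance of \<open>V\<close> makes the image of the coset in
    \<open>induced_endo\<close> a singleton, so that \<open>the_elem\<close> has its intended
    value.\<close>
  have "V #> \<theta> b = V #> \<theta> a" if b: "b \<in> V #> a" for b
  proof -
    obtain v where v: "v \<in> V" "b = v \<otimes> a" using b by (auto simp: r_coset_def)
    have "\<theta> v \<in> V" using \<theta>V v by auto
    then have "V #> (\<theta> v \<otimes> \<theta> a) = V #> \<theta> a"
      using a(1) V.subset by (metis V.mem_carrier \<theta>.hom_closed V.rcos_const coset_mult_assoc is_group)
    then show ?thesis using v a(1) by simp
  qed
  moreover have "a \<in> V #> a" using a(1) V.subgroup_axioms by (rule rcos_self)
  ultimately have "(\<lambda>b. V #> \<theta> b) ` (V #> a) = {V #> \<theta> a}" by blast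
  then have "V #> g = V #> \<theta> a" using a(2) by (simp add: induced_endo_def)
  then have "g \<in> V #> \<theta> a" using rcos_self[OF g V.subgroup_axioms] by simp
  then show ?thesis using a(1) unfolding V_def[symmetric] r_coset_def by auto
qed

lemma (in group) funpow_hom:
  assumes "\<theta> \<in> hom G G"
  shows "\<theta> ^^ k \<in> hom G G"
proof (induction k)
  case 0
  show ?case by (rule homI) simp_all
next
  case (Suc k)
  show ?case using Group.hom_compose[OF Suc.IH assms] by (simp only: funpow.simps)
qed

text \<open>Composition with \<open>\<theta>\<close> is injective on the finite set of homomorphisms from \<open>G\<close> to \<open>P\<close>, so
  \<open>f\<close> is a periodic point.\<close>

lemma (in group) hom_to_p_group_periodic:
  assumes S: "finite S" "S \<subseteq> carrier G" "generate G S = carrier G"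
    and P: "group P" and p: "prime p" and ord: "order P = p ^ n"
    and f: "f \<in> hom G P" and \<theta>: "\<theta> \<in> hom G G"
    and iso: "induced_endo G (power_commutator_subgroup p G) \<theta>
      \<in> iso (G Mod power_commutator_subgroup p G) (G Mod power_commutator_subgroup p G)"
  obtains m where "m > 0" "\<And>g. g \<in> carrier G \<Longrightarrow> f ((\<theta> ^^ m) g) = f g"
proof -
  interpret P: group P by fact
  interpret \<theta>: group_hom G G \<theta> by unfold_locales fact
  have "p > 0" using p by (simp add: prime_gt_0_nat)
  then have fin: "finite (carrier P)" using ord by (simp flip: P.order_gt_0_iff_finite)
  have hom: "f \<circ> (\<theta> ^^ k) \<in> hom G P" for k by (rule Group.hom_compose[OF funpow_hom[OF \<theta>] f])
  \<comment> \<open>A homomorphism is determined by its values on the finite set \<open>S\<close>.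
    There are only finitely many such restrictions, so two powers of \<open>\<theta>\<close> give
    the same one.\<close>
  define r where "r k = restrict (f \<circ> (\<theta> ^^ k)) S" for k
  have "range r \<subseteq> S \<rightarrow>\<^sub>E carrier P"
    using S(2) hom by (auto simp: r_def hom_def Pi_iff)
  then have "finite (range r)" using S(1) fin by (meson finite_PiE finite_subset)
  then have "\<not> inj r" using finite_imageD infinite_UNIV_nat by blast
  then obtain i j where ij: "r i = r j" "i < j"
    by (metis injI linorder_neqE_nat)
  have period: "f ((\<theta> ^^ i) g) = f ((\<theta> ^^ (i + (j - i))) g)" if g: "g \<in> carrier G" for g
  proof -
    interpret i: group_hom G P "f \<circ> (\<theta> ^^ i)" by unfold_locales (rule hom)
    have "(f \<circ> (\<theta> ^^ i)) s = (f \<circ> (\<theta> ^^ j)) s" if "s \<in> S" for s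
      using fun_cong[OF ij(1), of s] that by (simp add: r_def)
    from i.agree_on_generate[OF hom S(2) this] S(3) g ij(2) show ?thesis by simp
  qed
  \<comment> \<open>The preperiod \<open>i\<close> is lowered to 0: the hypothesis for
    \<open>Suc i\<close> says that \<open>f \<circ> (\<theta> ^^ i)\<close> and
    \<open>f \<circ> (\<theta> ^^ (i + d))\<close> agree on the image of \<open>\<theta>\<close>,
    hence everywhere by rigidity.\<close>
  have "\<forall>g\<in>carrier G. f ((\<theta> ^^ d) g) = f g"
    if "\<forall>g\<in>carrier G. f ((\<theta> ^^ i) g) = f ((\<theta> ^^ (i + d)) g)" for i d
    using that
  proof (induction i)
    case (Suc i)
    have "(f \<circ> (\<theta> ^^ i)) g = (f \<circ> (\<theta> ^^ (i + d))) g" if "g \<in> carrier G" for g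
    proof (rule homs_into_p_group_eq[OF P p ord hom hom
          endo_image_mod_power_commutator[OF \<theta> iso] _ _ that])
      show "(f \<circ> (\<theta> ^^ i)) l = (f \<circ> (\<theta> ^^ (i + d))) l" if "l \<in> \<theta> ` carrier G" for l
        using Suc.prems that by (auto simp: funpow_swap1)
    qed auto
    then show ?case by (intro Suc.IH) simp
  qed simp
  from this[of i "j - i"] period ij(2) show ?thesis by (intro that[of "j - i"]) auto
qed

section \<open>Ascending HNN extensions\<close>

lemma lift_word_simps [simp]:
  "lift_word [] = []"
  "lift_word ((x, b) # w) = (Some x, b) # lift_word w"
  "lift_word (u @ v) = lift_word u @ lift_word v"
  by (simp_all add: lift_word_def)

lemma lift_word_in_words [simp]:
  "lift_word w \<in> words (insert None (Some ` X)) \<longleftrightarrow> w \<in> words X"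
  by (induction w) auto

section \<open>The map \<open>emb\<close> from \<open>G\<close>, the stable letter and the universal
  property\<close>

locale HNN_endo = group G
  for G :: "('a, 'b) monoid_scheme" (structure) and X :: "'x set" and R :: "'x word set"
    and \<phi> :: "'x word set \<Rightarrow> 'a" and \<theta> :: "'a \<Rightarrow> 'a" +
  assumes presentation: "is_presentation G X R \<phi>"
    and endo: "\<theta> \<in> hom G G"
begin

definition "gens = insert None (Some ` X)"

definition "rels = lift_word ` R \<union>
  {[(None, True), (Some x, True), (None, False)] @ inv_word (lift_word w) |x w.
    x \<in> X \<and> w \<in> words X \<and> \<phi> (word_class X R w) = \<theta> (\<phi> (word_class X R [(x, True)]))}"

abbreviation "HNN \<equiv> ascending_HNN X R \<phi> \<theta>"

definition word_elem :: "'x word \<Rightarrow> 'a" where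
  "word_elem w = \<phi> (word_class X R w)"

definition emb :: "'a \<Rightarrow> 'x option word set" where
  "emb g = word_class gens rels (lift_word (SOME w. w \<in> words X \<and> word_elem w = g))"

definition stable :: "'x option word set" where
  "stable = word_class gens rels [(None, True)]"

lemma HNN_eq: "HNN = presented_group gens rels"
  by (simp add: ascending_HNN_def gens_def rels_def)

lemma R_words: "R \<subseteq> words X"
  using presentation by (simp add: is_presentation_def)

lemma \<phi>_iso: "\<phi> \<in> iso (presented_group X R) G"
  using presentation by (simp add: is_presentation_def)

lemma lift_word_gens [simp]: "lift_word w \<in> words gens \<longleftrightarrow> w \<in> words X"
  by (simp add: gens_def)

lemma None_gens [simp]: "None \<in> gens"
  by (simp add: gens_def)

lemma Some_gens [simp]: "Some x \<in> gens \<longleftrightarrow> x \<in> X"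
  by (auto simp: gens_def)

lemma rels_words: "rels \<subseteq> words gens"
  using R_words by (auto simp: rels_def)

lemma group_HNN: "group HNN"
  unfolding HNN_eq by (rule group_presented_group[OF rels_words])

interpretation H: group "HNN"
  by (rule group_HNN)

interpretation \<phi>: group_hom "presented_group X R" G \<phi>
  by (intro group_hom.intro group_presented_group[OF R_words] group_hom_axioms.intro is_group)
     (use \<phi>_iso in \<open>simp add: iso_def\<close>)

interpretation \<theta>: group_hom G G \<theta>
  by unfold_locales (rule endo)

lemma word_elem_closed [simp]: "w \<in> words X \<Longrightarrow> word_elem w \<in> carrier G"
  by (simp add: word_elem_def word_class_in_carrier[OF R_words])

lemma word_elem_Nil: "word_elem [] = \<one>"
  using \<phi>.hom_one by (simp add: word_elem_def one_presented_group[OF R_words])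

lemma word_elem_append:
  "u \<in> words X \<Longrightarrow> v \<in> words X \<Longrightarrow> word_elem (u @ v) = word_elem u \<otimes> word_elem v"
  by (simp add: word_elem_def word_class_in_carrier[OF R_words] flip: mult_word_class[OF R_words] \<phi>.hom_mult)

lemma word_elem_Cons:
  "l # w \<in> words X \<Longrightarrow> word_elem (l # w) = word_elem [l] \<otimes> word_elem w"
  using word_elem_append[of "[l]" w] by simp

lemma word_elem_inv_letter: "x \<in> X \<Longrightarrow> word_elem [(x, False)] = inv word_elem [(x, True)]"
  using \<phi>.hom_inv[of "word_class X R [(x, True)]"]
  by (simp add: word_elem_def word_class_in_carrier[OF R_words] inv_word_class[OF R_words])

lemma word_elemE:
  assumes "g \<in> carrier G"
  obtains w where "w \<in> words X" "word_elem w = g"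
proof -
  have "g \<in> \<phi> ` carrier (presented_group X R)"
    using assms \<phi>_iso by (simp add: iso_def bij_betw_def)
  then show ?thesis
    using that by (auto simp: word_elem_def elim!: carrier_presented_groupE[OF R_words])
qed

lemma word_elem_eqD:
  assumes "u \<in> words X" "v \<in> words X" "word_elem u = word_elem v"
  shows "(u, v) \<in> word_cong X R"
proof -
  have "inj_on \<phi> (carrier (presented_group X R))"
    using \<phi>_iso by (simp add: iso_def bij_betw_def)
  then have "word_class X R u = word_class X R v"
    using assms by (auto simp: word_elem_def word_class_in_carrier[OF R_words] dest: inj_onD)
  then show ?thesis using word_class_eq_iff[OF R_words assms(1,2)] by simp
qed

lemma lift_word_cong:
  assumes "(u, v) \<in> word_cong X R"
  shows "(lift_word u, lift_word v) \<in> word_cong gens rels"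
  using assms
proof (induction rule: word_cong.induct)
  case (cancel u v x b)
  then show ?case using word_cong.cancel[of "lift_word u" gens "lift_word v" "Some x"] by simp
next
  case (relator u v r)
  then show ?case
    using word_cong.relator[of "lift_word u" gens "lift_word v" "lift_word r" rels]
    by (simp add: rels_def)
qed (auto intro: word_cong.intros)

text \<open>The word chosen in \<open>emb\<close> is immaterial: words for the same element are
  congruent modulo \<open>R\<close>, and lifting carries this congruence to the extension.\<close>

lemma emb_word_elem:
  assumes "w \<in> words X"
  shows "emb (word_elem w) = word_class gens rels (lift_word w)"
proof -
  let ?v = "SOME v. v \<in> words X \<and> word_elem v = word_elem w"
  have v: "?v \<in> words X \<and> word_elem ?v = word_elem w"
    by (rule someI[of _ w]) (simp add: assms)
  then have "(?v, w) \<in> word_cong X R" using word_elem_eqD assms by blast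
  then have "word_class gens rels (lift_word ?v) = word_class gens rels (lift_word w)"
    using v assms by (simp add: word_class_eq_iff[OF rels_words] lift_word_cong)
  then show ?thesis by (simp add: emb_def)
qed

lemma emb_hom: "emb \<in> hom G HNN"
proof (rule homI)
  fix g assume "g \<in> carrier G"
  then show "emb g \<in> carrier HNN"
    by (auto elim!: word_elemE simp: emb_word_elem HNN_eq word_class_in_carrier[OF rels_words])
next
  fix g h assume "g \<in> carrier G" "h \<in> carrier G"
  then obtain u v where uv: "u \<in> words X" "word_elem u = g" "v \<in> words X" "word_elem v = h"
    by (metis word_elemE)
  then have "emb (g \<otimes> h) = word_class gens rels (lift_word (u @ v))"
    using emb_word_elem[of "u @ v"] word_elem_append by simp
  also have "\<dots> = emb g \<otimes>\<^bsub>HNN\<^esub> emb h"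
    using uv emb_word_elem by (auto simp: HNN_eq mult_word_class[OF rels_words])
  finally show "emb (g \<otimes> h) = emb g \<otimes>\<^bsub>HNN\<^esub> emb h" .
qed

interpretation emb: group_hom G HNN emb
  by unfold_locales (rule emb_hom)

lemma stable_closed [simp]: "stable \<in> carrier HNN"
  by (simp add: stable_def HNN_eq word_class_in_carrier[OF rels_words])

lemma stable_emb_letter:
  assumes x: "x \<in> X"
  shows "stable \<otimes>\<^bsub>HNN\<^esub> emb (word_elem [(x, True)]) \<otimes>\<^bsub>HNN\<^esub> inv\<^bsub>HNN\<^esub> stable = emb (\<theta> (word_elem [(x, True)]))"
proof -
  let ?a = "word_elem [(x, True)]"
  have a: "?a \<in> carrier G" using x by simp
  \<comment> \<open>Any word for \<open>\<theta> ?a\<close> will do, as \<open>rels\<close> contains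
    a relator for each of them.\<close>
  obtain w where w: "w \<in> words X" "word_elem w = \<theta> ?a" using word_elemE \<theta>.hom_closed[OF a] by blast
  let ?l = "[(None, True), (Some x, True), (None, False)]"
  have "?l @ inv_word (lift_word w) \<in> rels"
    using w x by (auto simp: rels_def word_elem_def)
  then have "word_class gens rels (?l @ inv_word (lift_word w)) = \<one>\<^bsub>HNN\<^esub>"
    by (simp add: HNN_eq word_class_relator[OF rels_words] del: append.simps)
  then have "word_class gens rels ?l \<otimes>\<^bsub>HNN\<^esub> inv\<^bsub>HNN\<^esub> word_class gens rels (lift_word w) = \<one>\<^bsub>HNN\<^esub>"
    using w x by (simp add: HNN_eq inv_word_class[OF rels_words] mult_word_class[OF rels_words])
  then have "word_class gens rels ?l = word_class gens rels (lift_word w)"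
    using w x H.inv_equality[of "word_class gens rels ?l" "inv\<^bsub>HNN\<^esub> word_class gens rels (lift_word w)"]
    by (simp add: HNN_eq word_class_in_carrier[OF rels_words] group.inv_inv[OF group_presented_group[OF rels_words]]
        group.inv_closed[OF group_presented_group[OF rels_words]])
  moreover have "word_class gens rels ?l =
      stable \<otimes>\<^bsub>HNN\<^esub> emb ?a \<otimes>\<^bsub>HNN\<^esub> inv\<^bsub>HNN\<^esub> stable"
    using x by (simp add: emb_word_elem stable_def HNN_eq inv_word_class[OF rels_words] mult_word_class[OF rels_words])
  ultimately show ?thesis using emb_word_elem[OF w(1)] w(2) by simp
qed

text \<open>Both sides are homomorphisms in \<open>g\<close>, and they agree on letters by the
  relators; inverse letters and products then follow by induction on a word for
  \<open>g\<close>.\<close>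

lemma stable_emb:
  assumes "g \<in> carrier G"
  shows "stable \<otimes>\<^bsub>HNN\<^esub> emb g \<otimes>\<^bsub>HNN\<^esub> inv\<^bsub>HNN\<^esub> stable = emb (\<theta> g)"
proof -
  define c where "c g = stable \<otimes>\<^bsub>HNN\<^esub> emb g \<otimes>\<^bsub>HNN\<^esub> inv\<^bsub>HNN\<^esub> stable" for g
  have c: "c \<in> hom G HNN"
  proof (rule homI)
    fix g h assume gh: "g \<in> carrier G" "h \<in> carrier G"
    have "inv\<^bsub>HNN\<^esub> stable \<otimes>\<^bsub>HNN\<^esub> (stable \<otimes>\<^bsub>HNN\<^esub> (emb h \<otimes>\<^bsub>HNN\<^esub> inv\<^bsub>HNN\<^esub> stable)) = emb h \<otimes>\<^bsub>HNN\<^esub> inv\<^bsub>HNN\<^esub> stable"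
      using gh by (simp flip: H.m_assoc)
    then show "c (g \<otimes> h) = c g \<otimes>\<^bsub>HNN\<^esub> c h"
      using gh by (simp add: c_def H.m_assoc)
  qed (simp add: c_def)
  interpret c: group_hom G HNN c by unfold_locales (rule c)
  have "c (word_elem w) = emb (\<theta> (word_elem w))" if "w \<in> words X" for w
    using that
  proof (induction w)
    case Nil
    then show ?case by (simp add: word_elem_Nil)
  next
    case (Cons l w)
    obtain x b where l: "l = (x, b)" by (cases l)
    have x: "x \<in> X" using Cons.prems l by simp
    have "c (word_elem [(x, True)]) = emb (\<theta> (word_elem [(x, True)]))"
      using stable_emb_letter[OF x] by (simp add: c_def)
    then have "c (word_elem [l]) = emb (\<theta> (word_elem [l]))"
      using x l by (cases b) (simp_all add: word_elem_inv_letter)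
    then show ?case using Cons x l by (simp add: word_elem_Cons[of "(x, b)" w])
  qed
  then show ?thesis using assms word_elemE c_def by metis
qed

text \<open>Each letter is the stable letter, its inverse, or an image of an element of
  \<open>G\<close>. This lets the induction over \<open>generate\<close> in
  \<open>stable_letter_normal_form\<close> reach every element of the extension.\<close>

lemma generate_HNN: "generate HNN (insert stable (emb ` carrier G)) = carrier HNN"
proof -
  let ?S = "insert stable (emb ` carrier G)"
  have S: "?S \<subseteq> carrier HNN" by auto
  have "word_class gens rels w \<in> generate HNN ?S" if "w \<in> words gens" for w
    using that
  proof (induction w)
    case Nil
    then show ?case using generate.one[of HNN ?S] by (simp add: HNN_eq one_presented_group[OF rels_words])
  next
    case (Cons l w)
    have "word_class gens rels [l] \<in> generate HNN ?S"
    proof (cases l)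
      case (Pair y b)
      show ?thesis
      proof (cases y)
        case None
        have "inv\<^bsub>HNN\<^esub> stable = word_class gens rels [(None, False)]"
          by (simp add: stable_def HNN_eq inv_word_class[OF rels_words])
        then show ?thesis
          using Pair None generate.incl[of stable ?S HNN] generate.inv[of stable ?S HNN]
          by (cases b) (simp_all add: stable_def)
      next
        case (Some x)
        then have "x \<in> X" using Cons.prems Pair by simp
        then have "word_class gens rels [l] = emb (word_elem [(x, b)])" "word_elem [(x, b)] \<in> carrier G"
          using Some Pair by (simp_all add: emb_word_elem)
        then show ?thesis using generate.incl[of "word_class gens rels [l]" ?S HNN] by blast
      qed
    qed
    from generate.eng[OF this Cons.IH] Cons.prems show ?case
      by (simp add: HNN_eq mult_word_class[OF rels_words])
  qed
  moreover have "generate HNN ?S \<subseteq> carrier HNN" using H.generate_incl[OF S] .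
  ultimately show ?thesis
    by (auto simp: HNN_eq elim!: carrier_presented_groupE[OF rels_words])
qed

text \<open>Sending letters of \<open>X\<close> as \<open>\<rho>\<close> does and the stable letter
  to \<open>\<tau>\<close> respects all relators: lifted words evaluate through
  \<open>\<rho>\<close>, which settles \<open>R\<close>, and the relators with the stable letter
  become instances of \<open>rel\<close>.\<close>

lemma HNN_universal:
  assumes K: "group K" and \<rho>: "\<rho> \<in> hom G K" and \<tau>: "\<tau> \<in> carrier K"
    and rel: "\<And>g. g \<in> carrier G \<Longrightarrow> \<tau> \<otimes>\<^bsub>K\<^esub> \<rho> g = \<rho> (\<theta> g) \<otimes>\<^bsub>K\<^esub> \<tau>"
  obtains F where "F \<in> hom HNN K" "F stable = \<tau>" "\<And>g. g \<in> carrier G \<Longrightarrow> F (emb g) = \<rho> g"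
proof -
  interpret K: group K by fact
  interpret \<rho>: group_hom G K \<rho> by unfold_locales fact
  define \<psi> where "\<psi> y = (case y of None \<Rightarrow> \<tau> | Some x \<Rightarrow> \<rho> (word_elem [(x, True)]))" for y
  have \<psi>: "\<psi> \<in> gens \<rightarrow> carrier K" using \<tau> by (auto simp: gens_def \<psi>_def)
  have val_lift: "word_val K \<psi> (lift_word w) = \<rho> (word_elem w)" if "w \<in> words X" for w
    using that
  proof (induction w)
    case Nil
    then show ?case by (simp add: word_elem_Nil)
  next
    case (Cons l w)
    obtain x b where l: "l = (x, b)" by (cases l)
    have x: "x \<in> X" using Cons.prems l by simp
    have "letter_val K \<psi> (Some x, b) = \<rho> (word_elem [l])"
      using x l by (cases b) (simp_all add: \<psi>_def word_elem_inv_letter)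
    then show ?case using Cons l x by (simp add: word_elem_Cons[of "(x, b)" w] del: letter_val.simps)
  qed
  have val_rels: "word_val K \<psi> r = \<one>\<^bsub>K\<^esub>" if r: "r \<in> rels" for r
  proof -
    from r consider r' where "r' \<in> R" "r = lift_word r'"
      | x w where "x \<in> X" "w \<in> words X" "word_elem w = \<theta> (word_elem [(x, True)])"
          "r = [(None, True), (Some x, True), (None, False)] @ inv_word (lift_word w)"
      unfolding rels_def word_elem_def by blast
    then show ?thesis
    proof cases
      case 1
      then have "word_elem r' = \<one>" using \<phi>.hom_one by (simp add: word_elem_def word_class_relator[OF R_words])
      then show ?thesis using 1 R_words val_lift by auto
    next
      case 2
      let ?a = "word_elem [(x, True)]"
      have a: "?a \<in> carrier G" using 2 by simp
      have "word_val K \<psi> r = \<tau> \<otimes>\<^bsub>K\<^esub> \<rho> ?a \<otimes>\<^bsub>K\<^esub> inv\<^bsub>K\<^esub> \<tau> \<otimes>\<^bsub>K\<^esub> inv\<^bsub>K\<^esub> \<rho> (\<theta> ?a)"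
        using 2 a \<tau> K.word_val_inv_word[OF \<psi>, of "lift_word w"] val_lift[of w]
        by (simp add: \<psi>_def K.m_assoc)
      then show ?thesis using rel[OF a] a \<tau> by (simp add: K.m_assoc)
    qed
  qed
  obtain F where F: "F \<in> hom (presented_group gens rels) K"
    "\<And>w. w \<in> words gens \<Longrightarrow> F (word_class gens rels w) = word_val K \<psi> w"
    using K.presented_group_universal[OF \<psi> rels_words val_rels] by blast
  show ?thesis
  proof
    show "F \<in> hom HNN K" using F(1) by (simp add: HNN_eq)
    show "F stable = \<tau>" using \<tau> by (simp add: stable_def F(2) \<psi>_def)
    fix g assume g: "g \<in> carrier G"
    show "F (emb g) = \<rho> g"
    proof -
      obtain w where "w \<in> words X" "word_elem w = g" using word_elemE[OF g] .
      then show ?thesis using emb_word_elem[of w] val_lift[of w] F(2)[of "lift_word w"] by simp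
    qed
  qed
qed

end

section \<open>Residual finiteness\<close>

text \<open>The kernel serves, because its quotient embeds into the finite group
  \<open>H\<close>.\<close>

lemma (in group_hom) normal_avoiding_if_finite_codomain:
  assumes "finite (carrier H)" "x \<in> carrier G" "h x \<noteq> \<one>\<^bsub>H\<^esub>"
  shows "\<exists>N. N \<lhd> G \<and> finite (rcosets N) \<and> x \<notin> N"
proof (intro exI conjI)
  show "kernel G H h \<lhd> G" by (rule normal_kernel)
  show "x \<notin> kernel G H h" using assms(3) by (simp add: kernel_def)
  have "(\<lambda>X. the_elem (h ` X)) ` carrier (G Mod kernel G H h) \<subseteq> carrier H"
    using FactGroup_hom by (auto simp: hom_def)
  then have "finite (carrier (G Mod kernel G H h))"
    using FactGroup_inj_on assms(1) finite_imageD finite_subset by blast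
  then show "finite (rcosets kernel G H h)" by (simp add: FactGroup_def)
qed

section \<open>The finite permutation representation given by a periodic homomorphism\<close>

lemma BijI:
  assumes "f \<in> extensional S" "\<And>x. x \<in> S \<Longrightarrow> f x \<in> S" "\<And>x. x \<in> S \<Longrightarrow> g x \<in> S"
    and "\<And>x. x \<in> S \<Longrightarrow> g (f x) = x" "\<And>x. x \<in> S \<Longrightarrow> f (g x) = x"
  shows "f \<in> Bij S"
  unfolding Bij_def using assms by (auto intro!: bij_betw_byWitness[where f' = g])

lemma finite_carrier_BijGroup: "finite S \<Longrightarrow> finite (carrier (BijGroup S))"
proof -
  assume "finite S"
  then have "finite (S \<rightarrow>\<^sub>E S)" by (simp add: finite_PiE)
  moreover have "Bij S \<subseteq> S \<rightarrow>\<^sub>E S" by (auto simp: Bij_def PiE_def dest: bij_betw_imp_funcset)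
  ultimately show ?thesis by (simp add: BijGroup_def finite_subset)
qed

text \<open>The image of \<open>G\<close> and \<open>t\<close> in the wreath product of \<open>P\<close> with \<open>\<int>/m\<close>, as permutations of
  \<open>P \<times> {0, \<dots>, m - 1}\<close>: \<open>g\<close> acts on the \<open>i\<close>-th copy of \<open>P\<close> through \<open>f \<circ> \<theta>\<^sup>i\<close>, and \<open>t\<close> shifts the
  copies cyclically.\<close>

lemma (in group) periodic_hom_action:
  assumes P: "group P" and f: "f \<in> hom G P" and \<theta>: "\<theta> \<in> hom G G"
    and m: "m > 0" and period: "\<And>g. g \<in> carrier G \<Longrightarrow> f ((\<theta> ^^ m) g) = f g"
  defines "K \<equiv> BijGroup (carrier P \<times> {..<m})"
  obtains \<rho> \<tau> where "\<rho> \<in> hom G K" "\<tau> \<in> carrier K"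
    "\<And>g. g \<in> carrier G \<Longrightarrow> \<tau> \<otimes>\<^bsub>K\<^esub> \<rho> g = \<rho> (\<theta> g) \<otimes>\<^bsub>K\<^esub> \<tau>"
    "\<And>g. g \<in> carrier G \<Longrightarrow> \<rho> g = \<one>\<^bsub>K\<^esub> \<Longrightarrow> f g = \<one>\<^bsub>P\<^esub>"
proof -
  interpret P: group P by fact
  interpret f: group_hom G P f by unfold_locales fact
  interpret \<theta>k: group_hom G G "\<theta> ^^ k" for k by unfold_locales (rule funpow_hom[OF \<theta>])
  define S where "S = carrier P \<times> {..<m}"
  define \<rho> where "\<rho> g = (\<lambda>x\<in>S. (f ((\<theta> ^^ snd x) g) \<otimes>\<^bsub>P\<^esub> fst x, snd x))" for g
  \<comment> \<open>The shift goes down: \<open>\<theta> g\<close> acts on copy \<open>i - 1\<close>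
    as \<open>g\<close> acts on copy \<open>i\<close>, which is exactly the relation required of
    \<open>\<tau>\<close>.\<close>
  define \<tau> where "\<tau> = (\<lambda>x\<in>S. (fst x, if snd x = 0 then m - 1 else snd x - 1))"
  have \<rho>B: "\<rho> g \<in> Bij S" if g: "g \<in> carrier G" for g
  proof (rule BijI[where g = "\<rho> (inv g)"])
    show "\<rho> g \<in> extensional S" by (simp add: \<rho>_def)
    fix x assume x: "x \<in> S"
    show *: "\<rho> g x \<in> S" "\<rho> (inv g) x \<in> S" using x g by (auto simp: \<rho>_def S_def)
    show "\<rho> (inv g) (\<rho> g x) = x" "\<rho> g (\<rho> (inv g) x) = x"
      using x g * by (auto simp: \<rho>_def S_def simp flip: P.m_assoc)
  qed
  have \<tau>B: "\<tau> \<in> Bij S"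
    using m by (intro BijI[where g = "\<lambda>x. (fst x, if snd x = m - 1 then 0 else snd x + 1)"])
      (auto simp: \<tau>_def S_def)
  have mult: "a \<otimes>\<^bsub>K\<^esub> b = compose S a b" if "a \<in> Bij S" "b \<in> Bij S" for a b
    using that by (simp add: K_def BijGroup_def S_def)
  show ?thesis
  proof
    show "\<tau> \<in> carrier K" using \<tau>B by (simp add: K_def BijGroup_def S_def)
    show "\<rho> \<in> hom G K"
    proof (rule homI)
      fix g h assume gh: "g \<in> carrier G" "h \<in> carrier G"
      have "\<rho> (g \<otimes> h) x = \<rho> g (\<rho> h x)" if "x \<in> S" for x
        using gh that by (auto simp: \<rho>_def S_def P.m_assoc)
      then have "\<rho> (g \<otimes> h) = compose S (\<rho> g) (\<rho> h)"
        by (intro extensionalityI[of _ S]) (simp_all add: compose_def, simp add: \<rho>_def)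
      then show "\<rho> (g \<otimes> h) = \<rho> g \<otimes>\<^bsub>K\<^esub> \<rho> h"
        using gh by (simp add: mult \<rho>B)
    qed (use \<rho>B in \<open>simp add: K_def BijGroup_def S_def\<close>)
    fix g assume g: "g \<in> carrier G"
    have \<theta>g: "\<theta> g \<in> carrier G" using \<theta>k.hom_closed[of g 1] g by simp
    \<comment> \<open>Copy 0 wraps around to copy \<open>m - 1\<close>, and there the relation
      amounts to the periodicity of \<open>f\<close>.\<close>
    have last: "f ((\<theta> ^^ (m - 1)) (\<theta> g)) = f g"
      using period[OF g] m by (cases m) (simp_all add: funpow_swap1)
    have "\<tau> (\<rho> g x) = \<rho> (\<theta> g) (\<tau> x)" if "x \<in> S" for x
    proof -
      obtain q i where x: "x = (q, i)" "q \<in> carrier P" "i < m" using \<open>x \<in> S\<close> by (auto simp: S_def)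
      show ?thesis
      proof (cases i)
        case 0
        then show ?thesis using x m g \<theta>g last by (simp add: \<rho>_def \<tau>_def S_def)
      next
        case (Suc k)
        then show ?thesis using x m g \<theta>g by (simp add: \<rho>_def \<tau>_def S_def funpow_swap1)
      qed
    qed
    then show "\<tau> \<otimes>\<^bsub>K\<^esub> \<rho> g = \<rho> (\<theta> g) \<otimes>\<^bsub>K\<^esub> \<tau>"
      using g \<theta>g by (simp add: mult \<tau>B \<rho>B compose_def cong: restrict_cong)
    assume "\<rho> g = \<one>\<^bsub>K\<^esub>"
    \<comment> \<open>On copy 0 the element \<open>g\<close> acts through \<open>f\<close> itself,
      so the image of the identity of \<open>P\<close> reads off \<open>f g\<close>.\<close>
    moreover have "(\<one>\<^bsub>P\<^esub>, 0) \<in> S" using m by (simp add: S_def)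
    ultimately have "\<rho> g (\<one>\<^bsub>P\<^esub>, 0) = (\<one>\<^bsub>P\<^esub>, 0)" by (simp add: K_def BijGroup_def S_def)
    then show "f g = \<one>\<^bsub>P\<^esub>" using \<open>(\<one>\<^bsub>P\<^esub>, 0) \<in> S\<close> g by (simp add: \<rho>_def)
  qed
qed

section \<open>Normal form with respect to the stable letter\<close>

lemma (in group_hom) conj_pow_image:
  assumes t: "t \<in> carrier H" and \<theta>: "\<theta> \<in> carrier G \<rightarrow> carrier G"
    and conj: "\<And>g. g \<in> carrier G \<Longrightarrow> t \<otimes>\<^bsub>H\<^esub> h g \<otimes>\<^bsub>H\<^esub> inv\<^bsub>H\<^esub> t = h (\<theta> g)"
    and g: "g \<in> carrier G"
  shows "t [^]\<^bsub>H\<^esub> int n \<otimes>\<^bsub>H\<^esub> h g \<otimes>\<^bsub>H\<^esub> t [^]\<^bsub>H\<^esub> (- int n) \<in> h ` carrier G"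
  using g
proof (induction n arbitrary: g)
  case (Suc n)
  \<comment> \<open>The innermost \<open>t\<close> is split off, so that it turns \<open>h g\<close>
    into \<open>h (\<theta> g)\<close> and the induction hypothesis applies to
    \<open>\<theta> g\<close>.\<close>
  have eq: "t [^]\<^bsub>H\<^esub> int (Suc n) = t [^]\<^bsub>H\<^esub> int n \<otimes>\<^bsub>H\<^esub> t"
    "t [^]\<^bsub>H\<^esub> (- int (Suc n)) = inv\<^bsub>H\<^esub> t \<otimes>\<^bsub>H\<^esub> t [^]\<^bsub>H\<^esub> (- int n)"
    using t H.int_pow_mult[OF t, of "int n" 1] H.int_pow_mult[OF t, of "-1" "- int n"]
      H.int_pow_neg[OF t, of 1] by (simp_all add: add.commute)
  have "\<theta> g \<in> carrier G" using \<theta> Suc.prems by auto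
  from Suc.IH[OF this] show ?case
    using t Suc.prems by (simp add: eq H.m_assoc flip: conj del: of_nat_Suc)
qed auto

text \<open>Conjugation by \<open>t\<close> maps the image of \<open>h\<close> into itself, but its
  inverse need not, so only large \<open>n\<close> can be expected to work. Claiming all large
  \<open>n\<close> rather than one lets the two factors of a product be treated at different
  exponents.\<close>

lemma (in group_hom) stable_letter_normal_form:
  assumes t: "t \<in> carrier H" and \<theta>: "\<theta> \<in> carrier G \<rightarrow> carrier G"
    and conj: "\<And>g. g \<in> carrier G \<Longrightarrow> t \<otimes>\<^bsub>H\<^esub> h g \<otimes>\<^bsub>H\<^esub> inv\<^bsub>H\<^esub> t = h (\<theta> g)"
    and x: "x \<in> generate H (insert t (h ` carrier G))"
  shows "\<exists>e. \<exists>n0. \<forall>n\<ge>n0. t [^]\<^bsub>H\<^esub> (n::int) \<otimes>\<^bsub>H\<^esub> x \<otimes>\<^bsub>H\<^esub> t [^]\<^bsub>H\<^esub> (- (n + e)) \<in> h ` carrier G"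
proof -
  let ?S = "insert t (h ` carrier G)"
  have S: "?S \<subseteq> carrier H" using t by auto
  have one: "\<one>\<^bsub>H\<^esub> \<in> h ` carrier G" using hom_one by (metis G.one_closed imageI)
  have pow: "t [^]\<^bsub>H\<^esub> n \<otimes>\<^bsub>H\<^esub> t [^]\<^bsub>H\<^esub> e \<otimes>\<^bsub>H\<^esub> t [^]\<^bsub>H\<^esub> (- (n + e)) = \<one>\<^bsub>H\<^esub>" for n e :: int
    using t by (simp flip: H.int_pow_mult)
  \<comment> \<open>This covers the identity, the generators and their inverses: an image under
    \<open>h\<close> takes exponent 0, and a power of \<open>t\<close> takes its own exponent, which
    leaves the identity for every \<open>n\<close>.\<close>
  have base: "\<exists>e n0. \<forall>n\<ge>n0. t [^]\<^bsub>H\<^esub> (n::int) \<otimes>\<^bsub>H\<^esub> y \<otimes>\<^bsub>H\<^esub> t [^]\<^bsub>H\<^esub> (- (n + e)) \<in> h ` carrier G"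
    if "y \<in> h ` carrier G \<or> y = t [^]\<^bsub>H\<^esub> (e::int)" for y e
    using that
  proof
    assume "y \<in> h ` carrier G"
    then obtain g where g: "g \<in> carrier G" "y = h g" by auto
    have "t [^]\<^bsub>H\<^esub> n \<otimes>\<^bsub>H\<^esub> y \<otimes>\<^bsub>H\<^esub> t [^]\<^bsub>H\<^esub> (- (n + 0)) \<in> h ` carrier G" if "n \<ge> 0" for n :: int
      using conj_pow_image[OF t \<theta> conj g(1), of "nat n"] that g(2) by simp
    then show ?thesis by blast
  next
    assume "y = t [^]\<^bsub>H\<^esub> e"
    then show ?thesis using pow[of _ e] one by metis
  qed
  from x show ?thesis
  proof (induction rule: generate.induct)
    case one
    show ?case by (rule base[of _ 0]) simp
  next
    case (incl y)
    then show ?case using t by (intro base[of y 1]) auto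
  next
    case (inv y)
    show ?case
    proof (rule base[of _ "-1"], cases "y = t")
      case False
      then obtain g where "g \<in> carrier G" "y = h g" using inv by auto
      then have "inv\<^bsub>H\<^esub> y = h (inv g)" "inv g \<in> carrier G" by simp_all
      then show "inv\<^bsub>H\<^esub> y \<in> h ` carrier G \<or> inv\<^bsub>H\<^esub> y = t [^]\<^bsub>H\<^esub> (-1::int)" by blast
    qed (use t H.int_pow_neg[OF t, of 1] in simp)
  next
    case (eng y z)
    obtain e1 n1 where 1: "\<And>n::int. n \<ge> n1 \<Longrightarrow> t [^]\<^bsub>H\<^esub> n \<otimes>\<^bsub>H\<^esub> y \<otimes>\<^bsub>H\<^esub> t [^]\<^bsub>H\<^esub> (- (n + e1)) \<in> h ` carrier G"
      using eng.IH(1) by blast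
    obtain e2 n2 where 2: "\<And>n::int. n \<ge> n2 \<Longrightarrow> t [^]\<^bsub>H\<^esub> n \<otimes>\<^bsub>H\<^esub> z \<otimes>\<^bsub>H\<^esub> t [^]\<^bsub>H\<^esub> (- (n + e2)) \<in> h ` carrier G"
      using eng.IH(2) by blast
    have yz: "y \<in> carrier H" "z \<in> carrier H" using eng.hyps H.generate_in_carrier[OF S] by auto
    have "t [^]\<^bsub>H\<^esub> n \<otimes>\<^bsub>H\<^esub> (y \<otimes>\<^bsub>H\<^esub> z) \<otimes>\<^bsub>H\<^esub> t [^]\<^bsub>H\<^esub> (- (n + (e1 + e2))) \<in> h ` carrier G"
      if n: "n \<ge> max n1 (n2 - e1)" for n :: int
    proof -
      \<comment> \<open>\<open>y\<close> is treated at \<open>n\<close> and \<open>z\<close> at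
        \<open>n + e1\<close>, so that the inner powers of \<open>t\<close> cancel; the bound
        \<open>n2 - e1\<close> makes the second exponent large enough.\<close>
      let ?a = "t [^]\<^bsub>H\<^esub> n \<otimes>\<^bsub>H\<^esub> y \<otimes>\<^bsub>H\<^esub> t [^]\<^bsub>H\<^esub> (- (n + e1))"
      let ?b = "t [^]\<^bsub>H\<^esub> (n + e1) \<otimes>\<^bsub>H\<^esub> z \<otimes>\<^bsub>H\<^esub> t [^]\<^bsub>H\<^esub> (- (n + e1 + e2))"
      have "t [^]\<^bsub>H\<^esub> (- (n + e1)) \<otimes>\<^bsub>H\<^esub> (t [^]\<^bsub>H\<^esub> (n + e1) \<otimes>\<^bsub>H\<^esub> w) = w" if "w \<in> carrier H" for w
        using t that by (simp add: H.int_pow_mult[symmetric] flip: H.m_assoc)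
      then have "?a \<otimes>\<^bsub>H\<^esub> ?b = t [^]\<^bsub>H\<^esub> n \<otimes>\<^bsub>H\<^esub> (y \<otimes>\<^bsub>H\<^esub> z) \<otimes>\<^bsub>H\<^esub> t [^]\<^bsub>H\<^esub> (- (n + (e1 + e2)))"
        using t yz by (simp add: H.m_assoc add.assoc del: minus_add_distrib)
      moreover have "?a \<in> h ` carrier G" "?b \<in> h ` carrier G" using 1[of n] 2[of "n + e1"] n by auto
      moreover have "a \<otimes>\<^bsub>H\<^esub> b \<in> h ` carrier G" if "a \<in> h ` carrier G" "b \<in> h ` carrier G" for a b
        using that by (auto simp flip: hom_mult)
      ultimately show ?thesis by metis
    qed
    then show ?case by blast
  qed
qed

section \<open>Residual finiteness by the two cases of the exponent sum\<close>

theorem corollary6p3: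
  fixes p :: nat
    and G :: "('a, 'b) monoid_scheme"
    and \<theta> :: "'a \<Rightarrow> 'a"
    and X :: "'x set"
    and R :: "'x word set"
    and \<phi> :: "'x word set \<Rightarrow> 'a"
  assumes "prime p"
    and "group G"
    and "finitely_generated_group G"
    and "residually_finite_p p G"
    and "\<theta> \<in> hom G G"
    and "inj_on \<theta> (carrier G)"
    and "induced_endo G (power_commutator_subgroup p G) \<theta>
           \<in> iso (G Mod power_commutator_subgroup p G) (G Mod power_commutator_subgroup p G)"
    and "is_presentation G X R \<phi>"
  shows "residually_finite (ascending_HNN X R \<phi> \<theta>)"
proof -
  interpret G: group G by fact
  interpret HNN_endo G X R \<phi> \<theta> by unfold_locales fact+
  let ?H = "ascending_HNN X R \<phi> \<theta>"
  interpret H: group ?H by (rule group_HNN)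
  interpret emb: group_hom G ?H emb by unfold_locales (rule emb_hom)
  have \<theta>: "\<theta> \<in> carrier G \<rightarrow> carrier G" using assms(5) by (auto simp: hom_def)
  obtain S where S: "finite S" "S \<subseteq> carrier G" "generate G S = carrier G"
    using assms(3) by (auto simp: finitely_generated_group_def)
  have sep: "\<exists>N. N \<lhd> ?H \<and> finite (rcosets\<^bsub>?H\<^esub> N) \<and> x \<notin> N"
    if x: "x \<in> carrier ?H" "x \<noteq> \<one>\<^bsub>?H\<^esub>" for x
  proof -
    \<comment> \<open>A single exponent \<open>n\<close> beyond the bound suffices; \<open>e\<close>
      is the exponent sum of the stable letter in \<open>x\<close>.\<close>
    obtain e n where "stable [^]\<^bsub>?H\<^esub> (n::int) \<otimes>\<^bsub>?H\<^esub> x \<otimes>\<^bsub>?H\<^esub> stable [^]\<^bsub>?H\<^esub> (- (n + e)) \<in> emb ` carrier G"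
      using emb.stable_letter_normal_form[OF stable_closed \<theta> stable_emb, of x] x(1)
      unfolding generate_HNN by blast
    then obtain g where g: "g \<in> carrier G"
      "stable [^]\<^bsub>?H\<^esub> n \<otimes>\<^bsub>?H\<^esub> x \<otimes>\<^bsub>?H\<^esub> stable [^]\<^bsub>?H\<^esub> (- (n + e)) = emb g" by auto
    show ?thesis
    proof (cases "e = 0")
      case True
      \<comment> \<open>For \<open>e = 0\<close> the element \<open>emb g\<close> is a conjugate of
        \<open>x\<close>, hence nontrivial.\<close>
      have "g \<noteq> \<one>\<^bsub>G\<^esub>"
      proof
        assume "g = \<one>\<^bsub>G\<^esub>"
        then have "stable [^]\<^bsub>?H\<^esub> n \<otimes>\<^bsub>?H\<^esub> x \<otimes>\<^bsub>?H\<^esub> inv\<^bsub>?H\<^esub> (stable [^]\<^bsub>?H\<^esub> n) = \<one>\<^bsub>?H\<^esub>"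
          using g True by (simp add: H.int_pow_neg)
        then have "stable [^]\<^bsub>?H\<^esub> n \<otimes>\<^bsub>?H\<^esub> x = stable [^]\<^bsub>?H\<^esub> n"
          using x(1) by (simp add: H.inv_solve_right')
        then show False using x by (simp add: H.l_cancel_one)
      qed
      then obtain N k where N: "N \<lhd> G" "finite (rcosets\<^bsub>G\<^esub> N)" "card (rcosets\<^bsub>G\<^esub> N) = p ^ k" "g \<notin> N"
        using assms(4) g(1) unfolding residually_finite_p_def by blast
      interpret N: normal N G by fact
      define P where "P = G Mod N"
      interpret P: group P unfolding P_def by (rule N.factorgroup_is_group)
      have ord: "order P = p ^ k" using N(3) by (simp add: P_def order_def FactGroup_def)
      have f: "(\<lambda>a. N #>\<^bsub>G\<^esub> a) \<in> hom G P" unfolding P_def by (rule N.r_coset_hom_Mod)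
      obtain m where m: "m > 0" "\<And>g. g \<in> carrier G \<Longrightarrow> N #>\<^bsub>G\<^esub> (\<theta> ^^ m) g = N #>\<^bsub>G\<^esub> g"
        using G.hom_to_p_group_periodic[OF S P.is_group assms(1) ord f assms(5,7)] by blast
      let ?K = "BijGroup (carrier P \<times> {..<m})"
      interpret K: group ?K by (rule group_BijGroup)
      \<comment> \<open>The pair satisfies the relation of the extension and so extends to
        \<open>F\<close>. As \<open>g\<close> survives in \<open>P\<close>, its permutation is
        nontrivial, and so is the image of its conjugate \<open>x\<close>.\<close>
      obtain \<rho> \<tau> where \<rho>: "\<rho> \<in> hom G ?K" "\<tau> \<in> carrier ?K"
        "\<And>g. g \<in> carrier G \<Longrightarrow> \<tau> \<otimes>\<^bsub>?K\<^esub> \<rho> g = \<rho> (\<theta> g) \<otimes>\<^bsub>?K\<^esub> \<tau>"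
        "\<And>g. g \<in> carrier G \<Longrightarrow> \<rho> g = \<one>\<^bsub>?K\<^esub> \<Longrightarrow> N #>\<^bsub>G\<^esub> g = \<one>\<^bsub>P\<^esub>"
        using G.periodic_hom_action[OF P.is_group f assms(5) m] by blast
      obtain F where F: "F \<in> hom ?H ?K" "\<And>g. g \<in> carrier G \<Longrightarrow> F (emb g) = \<rho> g"
        using HNN_universal[OF K.is_group \<rho>(1-3)] by blast
      interpret F: group_hom ?H ?K F by unfold_locales (rule F(1))
      have "N #>\<^bsub>G\<^esub> g \<noteq> N"
        using N(4) G.rcos_self[OF g(1) N.is_subgroup] by auto
      then have "\<rho> g \<noteq> \<one>\<^bsub>?K\<^esub>" using \<rho>(4)[OF g(1)] by (auto simp: P_def FactGroup_def)
      then have "F (emb g) \<noteq> \<one>\<^bsub>?K\<^esub>" using F(2)[OF g(1)] by simp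
      moreover have "F (emb g) = \<one>\<^bsub>?K\<^esub>" if "F x = \<one>\<^bsub>?K\<^esub>"
        using that x(1) True by (simp add: H.int_pow_neg flip: g(2))
      ultimately have "F x \<noteq> \<one>\<^bsub>?K\<^esub>" by blast
      moreover have "finite (carrier ?K)"
        using N(2) by (intro finite_carrier_BijGroup) (simp add: P_def FactGroup_def)
      ultimately show ?thesis using F.normal_avoiding_if_finite_codomain x(1) by blast
    next
      case False
      \<comment> \<open>A modulus above the absolute value of \<open>e\<close> does not divide the
        nonzero \<open>e\<close>. It also exceeds 1, so that 1 is a member of the carrier.\<close>
      define M where "M = nat \<bar>e\<bar> + 1"
      let ?K = "integer_mod_group M"
      interpret K: group ?K by simp
      have M: "M > 1" "int M = \<bar>e\<bar> + 1" using False by (auto simp: M_def)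
      have one: "1 \<in> carrier ?K" using M by simp
      obtain F where F: "F \<in> hom ?H ?K" "F stable = 1" "\<And>g. g \<in> carrier G \<Longrightarrow> F (emb g) = 0"
      proof (rule HNN_universal[OF K.is_group _ one, of "\<lambda>_. 0"])
        show "(\<lambda>_. 0) \<in> hom G ?K" by (rule homI) simp_all
      qed (use that in auto)
      interpret F: group_hom ?H ?K F by unfold_locales (rule F(1))
      have "F x \<noteq> \<one>\<^bsub>?K\<^esub>"
      proof
        assume "F x = \<one>\<^bsub>?K\<^esub>"
        \<comment> \<open>If \<open>x\<close> had trivial image, the outer powers of the stable
          letter would contribute \<open>n - (n + e)\<close>, whereas \<open>emb g\<close> is sent
          to 0.\<close>
        then have "F (emb g) = (- e) mod int M"
          using x(1) F(2) by (simp add: F.hom_int_pow int_pow_integer_mod_group mod_simps flip: g(2))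
        then have "int M dvd e" using F(3)[OF g(1)] by (simp add: mod_eq_0_iff_dvd)
        then show False using M(2) False zdvd_imp_le[of "int M" "\<bar>e\<bar>"] by auto
      qed
      moreover have "finite (carrier ?K)" by (simp add: carrier_integer_mod_group M_def)
      ultimately show ?thesis using F.normal_avoiding_if_finite_codomain x(1) by blast
    qed
  qed
  then show ?thesis by (simp add: residually_finite_def H.is_group)
qed

end
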